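(* Let $(X,\mu)$ be a Lebesgue space with $\mu(X)=1$ and let $\rho$ be a measurable summable semimetric on $(X,\mu)$. Then the following conditions are equivalent: 1) The triple $(X,\mu,\rho)$ is admissible, i.e., the semimetric $\rho$ is admissible for the measure space $(X,\mu)$. 2) For every $\varepsilon>0$, the semimetric $\rho$ has a finite $\varepsilon$-entropy: $\mathbb{H}_\varepsilon(\rho,\mu)<\infty$. 3) The measure $\mu$ can be approximated in the metric $K_\rho$ by discrete (i.e. finitely supported) probability measures: for every $\varepsilon>0$ there is a finitely supported probability measure $\nu$ on $X$ with $K_\rho(\mu,\nu)<\varepsilon$. 4) For $\mu$-almost all $x\in X$ and every $\varepsilon>0$, the ball of radius $\varepsilon$ (in the semimetric $\rho$) centered at $x$ has positive measure. 5) For every $\varepsilon>0$, the space $X$ can be represented as a union of measurable sets $X_0,X_1,\dots,X_k$ (for some $k$) such that $\mu(X_0)<\varepsilon$ and $\mathrm{essdiam}_\rho(X_j)<\varepsilon$ for $j=1,\dots,k$. 6) For every measurable set $A\subset X$ of positive measure, the essential infimum of the function $\rho$ on $A\times A$ (with respect to $\mu\times\mu$) is zero.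
   Context: A Lebesgue space with $\mu(X)=1$ is a standard probability space. A semimetric on $X$ is a function $\rho:X\times X\to[0,\infty)$ with $\rho(x,x)=0$, $\rho(x,y)=\rho(y,x)$ and $\rho(x,z)\le\rho(x,y)+\rho(y,z)$. Measurable means measurable on the Lebesgue space $(X\times X,\mu\times\mu)$, and summable means $\rho\in L^1(X\times X,\mu\times\mu)$. A measurable semimetric $\rho$ is admissible if there is $X_1\subset X$ of full measure such that $(X_1,\rho)$ is separable. $\mathrm{diam}_\rho(A)$ and $\mathrm{essdiam}_\rho(A)$ denote the diameter of $A$ and the essential diameter of $A$ (the $\mu\times\mu$-essential supremum of $\rho$ on $A\times A$). For $\varepsilon>0$, the $\varepsilon$-entropy $\mathbb{H}_\varepsilon(\rho,\mu)$ is $\log_2 k$, where $k$ is the smallest positive integer for which $X$ is the union of measurable sets $X_0,X_1,\dots,X_k$ with $\mu(X_0)<\varepsilon$ and $\mathrm{diam}_\rho(X_j)<\varepsilon$ for $j=1,\dots,k$; if no such $k$ exists, $\mathbb{H}_\varepsilon(\rho,\mu)=\infty$. The Kantorovich (transportation) distance between probability measures $\mu_1,\mu_2$ on $X$ is $K_\rho(\mu_1,\mu_2)=\inf_\Psi\iint_{X\times X}\rho(x,y)\,d\Psi(x,y)$, where $\Psi$ ranges over the probability measures on $X\times X$ whose projections to the two factors are $\mu_1$ and $\mu_2$. *)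

theory Defs
  imports "HOL-Probability.Probability"
begin

section \<open>Lebesgue spaces\<close>

definition isomorphic_mod0 :: "'a measure \<Rightarrow> 'b measure \<Rightarrow> bool" where
  "isomorphic_mod0 M N \<longleftrightarrow>
    (\<exists>X0 Y0 f g. X0 \<in> sets M \<and> space M - X0 \<in> null_sets M \<and>
       Y0 \<in> sets N \<and> space N - Y0 \<in> null_sets N \<and>
       f \<in> restrict_space M X0 \<rightarrow>\<^sub>M restrict_space N Y0 \<and>
       g \<in> restrict_space N Y0 \<rightarrow>\<^sub>M restrict_space M X0 \<and>
       (\<forall>x\<in>X0. g (f x) = x) \<and> (\<forall>y\<in>Y0. f (g y) = y) \<and>
       distr (restrict_space M X0) (restrict_space N Y0) f = restrict_space N Y0)"

text \<open>A normalized Lebesgue space (Rokhlin's standard probability space): a complete probability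
  space made of at most countably many atoms \<open>C\<close> and a rest that is isomorphic mod 0 to an interval
  \<open>{0..a}\<close> with Lebesgue measure. Either part may be absent: \<open>C\<close> may be empty, and \<open>a = 0\<close> makes the
  rest a null set.\<close>

definition lebesgue_prob_space :: "'a measure \<Rightarrow> bool" where
  "lebesgue_prob_space M \<longleftrightarrow> prob_space M \<and> complete_measure M \<and>
    (\<exists>C a. C \<subseteq> space M \<and> countable C \<and>
       (\<forall>x\<in>C. {x} \<in> sets M \<and> emeasure M {x} > 0) \<and> 0 \<le> (a::real) \<and>
       isomorphic_mod0 (restrict_space M (space M - C)) (restrict_space lebesgue {0..a}))"

section \<open>Semimetrics\<close>

definition semimetric_on :: "'a set \<Rightarrow> ('a \<Rightarrow> 'a \<Rightarrow> real) \<Rightarrow> bool" where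
  "semimetric_on X \<rho> \<longleftrightarrow>
    (\<forall>x\<in>X. \<forall>y\<in>X. 0 \<le> \<rho> x y) \<and> (\<forall>x\<in>X. \<rho> x x = 0) \<and> (\<forall>x\<in>X. \<forall>y\<in>X. \<rho> x y = \<rho> y x) \<and>
    (\<forall>x\<in>X. \<forall>y\<in>X. \<forall>z\<in>X. \<rho> x z \<le> \<rho> x y + \<rho> y z)"

text \<open>The Lebesgue space \<open>(X \<times> X, \<mu> \<times> \<mu>)\<close> carries the completed product measure.\<close>

definition square_measure :: "'a measure \<Rightarrow> ('a \<times> 'a) measure" where
  "square_measure M = completion (M \<Otimes>\<^sub>M M)"

definition measurable_semimetric :: "'a measure \<Rightarrow> ('a \<Rightarrow> 'a \<Rightarrow> real) \<Rightarrow> bool" where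
  "measurable_semimetric M \<rho> \<longleftrightarrow>
    semimetric_on (space M) \<rho> \<and> case_prod \<rho> \<in> borel_measurable (square_measure M)"

definition summable_semimetric :: "'a measure \<Rightarrow> ('a \<Rightarrow> 'a \<Rightarrow> real) \<Rightarrow> bool" where
  "summable_semimetric M \<rho> \<longleftrightarrow> integrable (square_measure M) (case_prod \<rho>)"

definition separable_on :: "'a set \<Rightarrow> ('a \<Rightarrow> 'a \<Rightarrow> real) \<Rightarrow> bool" where
  "separable_on X \<rho> \<longleftrightarrow>
    (\<exists>D\<subseteq>X. countable D \<and> (\<forall>x\<in>X. \<forall>\<epsilon>>0. \<exists>d\<in>D. \<rho> x d < \<epsilon>))"

definition admissible_semimetric :: "'a measure \<Rightarrow> ('a \<Rightarrow> 'a \<Rightarrow> real) \<Rightarrow> bool" where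
  "admissible_semimetric M \<rho> \<longleftrightarrow> measurable_semimetric M \<rho> \<and>
    (\<exists>X1\<in>sets M. space M - X1 \<in> null_sets M \<and> separable_on X1 \<rho>)"

definition semimetric_ball :: "'a measure \<Rightarrow> ('a \<Rightarrow> 'a \<Rightarrow> real) \<Rightarrow> 'a \<Rightarrow> real \<Rightarrow> 'a set" where
  "semimetric_ball M \<rho> x \<epsilon> = {y\<in>space M. \<rho> x y < \<epsilon>}"

section \<open>Diameters and entropy\<close>

text \<open>All diameters are taken in \<^typ>\<open>ennreal\<close>, so that they may be infinite and are \<open>0\<close> for
  the empty set (respectively for null sets).\<close>

definition diam :: "('a \<Rightarrow> 'a \<Rightarrow> real) \<Rightarrow> 'a set \<Rightarrow> ennreal" where
  "diam \<rho> A = (SUP p\<in>A \<times> A. ennreal (case_prod \<rho> p))"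

definition essdiam :: "'a measure \<Rightarrow> ('a \<Rightarrow> 'a \<Rightarrow> real) \<Rightarrow> 'a set \<Rightarrow> ennreal" where
  "essdiam M \<rho> A =
    esssup (restrict_space (square_measure M) (A \<times> A)) (\<lambda>p. ennreal (case_prod \<rho> p))"

definition essinf :: "'a measure \<Rightarrow> ('a \<Rightarrow> ennreal) \<Rightarrow> ennreal" where
  "essinf M f = Sup {z. AE x in M. z \<le> f x}"

definition entropy_cover :: "'a measure \<Rightarrow> ('a \<Rightarrow> 'a \<Rightarrow> real) \<Rightarrow> real \<Rightarrow> nat \<Rightarrow> bool" where
  "entropy_cover M \<rho> \<epsilon> k \<longleftrightarrow>
    (\<exists>X::nat \<Rightarrow> 'a set. (\<forall>j\<le>k. X j \<in> sets M) \<and> (\<Union>j\<le>k. X j) = space M \<and>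
       emeasure M (X 0) < ennreal \<epsilon> \<and> (\<forall>j\<in>{1..k}. diam \<rho> (X j) < ennreal \<epsilon>))"

definition eps_entropy :: "real \<Rightarrow> ('a \<Rightarrow> 'a \<Rightarrow> real) \<Rightarrow> 'a measure \<Rightarrow> ereal" where
  "eps_entropy \<epsilon> \<rho> M =
    (if \<exists>k\<ge>1. entropy_cover M \<rho> \<epsilon> k
     then ereal (log 2 (real (LEAST k. k \<ge> 1 \<and> entropy_cover M \<rho> \<epsilon> k)))
     else \<infinity>)"

section \<open>Kantorovich distance\<close>

definition couplings :: "'a measure \<Rightarrow> 'a measure \<Rightarrow> ('a \<times> 'a) measure set" where
  "couplings M N = {\<Psi>. prob_space \<Psi> \<and> sets \<Psi> = sets (M \<Otimes>\<^sub>M N) \<and>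
     distr \<Psi> M fst = M \<and> distr \<Psi> N snd = N}"

text \<open>A function that is merely measurable for the completion of \<open>\<mu> \<times> \<mu>\<close> need not be measurable for
  (the completion of) a coupling \<open>\<Psi>\<close>. The infimum ranges over those couplings for which the
  transportation cost is defined, because \<open>nn_integral\<close> of a non-measurable function is only a lower
  integral and could be spuriously small. The infimum over no coupling is \<open>\<infinity>\<close>.\<close>

definition kantorovich ::
    "('a \<Rightarrow> 'a \<Rightarrow> real) \<Rightarrow> 'a measure \<Rightarrow> 'a measure \<Rightarrow> ennreal" where
  "kantorovich \<rho> M N =
    (INF \<Psi>\<in>{\<Psi>\<in>couplings M N. case_prod \<rho> \<in> borel_measurable (completion \<Psi>)}.
       \<integral>\<^sup>+p. ennreal (case_prod \<rho> p) \<partial>completion \<Psi>)"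

definition finitely_supported :: "'a measure \<Rightarrow> bool" where
  "finitely_supported \<nu> \<longleftrightarrow> (\<exists>F\<in>sets \<nu>. finite F \<and> space \<nu> - F \<in> null_sets \<nu>)"

end

theory Submission
  imports Defs
begin

text \<open>The conditions are proved in the single cycle 1, 3, 2, 5, 6, 4, 1. A countable dense set yields a
  map with finitely many values that moves points by less than \<open>\<epsilon>\<close>, except on a set whose
  contribution to the transportation cost is small by dominated convergence. Conversely, if \<open>\<mu>\<close> is
  close to a measure on a finite set \<open>F\<close>, then by Markov's inequality a nearly optimal plan lives mostly
  where \<open>\<rho> < \<epsilon>\<close>, and the sections of that region over the points of \<open>F\<close> have small diameter.
  If a set of points had null balls of radius \<open>\<epsilon>\<close>, then by Fubini \<open>\<rho>\<close> would be at least \<open>\<epsilon>\<close> almost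
  everywhere on its square. Finally, when balls have positive measure, a maximal \<open>\<epsilon>\<close>-separated set
  is countable, since the balls of radius \<open>\<epsilon>/2\<close> around it are disjoint.

  As \<open>\<rho>\<close> is measurable only for the completed product, a section \<open>\<rho> x\<close> is measurable merely for
  almost every \<open>x\<close>; centers of balls have to be chosen among those \<open>x\<close>.\<close>

section \<open>Complete measures and atoms\<close>

text \<open>The preimages of a measurable set under \<open>f\<close> and \<open>g\<close> differ by
  a subset of a null set, which completeness makes measurable. This carries measurability from a
  version of \<open>\<rho>\<close> back to \<open>\<rho>\<close> itself.\<close>

lemma (in complete_measure) borel_measurable_AE_eq:
  assumes g: "g \<in> M \<rightarrow>\<^sub>M N" and eq: "AE x in M. f x = g x" and f: "f \<in> space M \<rightarrow> space N"
  shows "f \<in> M \<rightarrow>\<^sub>M N"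
proof (rule measurableI)
  fix A assume A: "A \<in> sets N"
  show "f -` A \<inter> space M \<in> sets M"
  proof (rule in_sets_AE)
    show "AE x in M. x \<in> g -` A \<inter> space M \<longleftrightarrow> x \<in> f -` A \<inter> space M"
      using eq by eventually_elim auto
  qed (use g A in \<open>auto intro: measurable_sets\<close>)
qed (use f in auto)

text \<open>Finite supports have to be measurable sets. A point is an atom, or it lies in
  \<open>X0\<close> and is the preimage of a single point of the interval because \<open>f\<close>
  is injective there, or it lies in the exceptional null set and completeness applies.\<close>

lemma lebesgue_prob_space_singleton:
  assumes leb: "lebesgue_prob_space M" and x: "x \<in> space M"
  shows "{x} \<in> sets M"
proof -
  from leb obtain C a where cm: "complete_measure M" and C: "C \<subseteq> space M" "countable C"
      and atoms: "\<And>x. x \<in> C \<Longrightarrow> {x} \<in> sets M"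
      and iso: "isomorphic_mod0 (restrict_space M (space M - C)) (restrict_space lebesgue {0..a::real})"
    unfolding lebesgue_prob_space_def by blast
  interpret complete_measure M by (fact cm)
  have "(\<Union>x\<in>C. {x}) \<in> sets M"
    by (rule sets.countable_UN') (use C atoms in auto)
  \<comment> \<open>Measurable subsets of the restricted space are measurable in \<open>M\<close>
    because the base set is.\<close>
  then have R: "space M - C \<in> sets M" by auto
  let ?N = "restrict_space M (space M - C)" and ?L = "restrict_space lebesgue {0..a}"
  from iso obtain X0 Y0 f g where X0: "X0 \<in> sets ?N" "space ?N - X0 \<in> null_sets ?N"
      and Y0: "Y0 \<in> sets ?L"
      and f: "f \<in> restrict_space ?N X0 \<rightarrow>\<^sub>M restrict_space ?L Y0"
      and gf: "\<And>x. x \<in> X0 \<Longrightarrow> g (f x) = x"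
    unfolding isomorphic_mod0_def by blast
  have spN: "space ?N = space M - C" by (auto simp: space_restrict_space)
  have X0R: "X0 \<subseteq> space M - C" using sets.sets_into_space[OF X0(1)] spN by simp
  have spX0: "space (restrict_space ?N X0) = X0"
    using X0R spN by (auto simp: space_restrict_space)
  consider "x \<in> C" | "x \<in> X0" | "x \<in> space ?N - X0" using x spN by blast
  then show ?thesis
  proof cases
    case 1 then show ?thesis by (rule atoms)
  next
    case 2
    have "f x \<in> space (restrict_space ?L Y0)"
      using measurable_space[OF f] 2 spX0 by blast
    then have fx: "f x \<in> Y0" "f x \<in> {0..a}" by (auto simp: space_restrict_space)
    have "{f x} \<in> sets ?L"
      using fx by (subst sets_restrict_space_iff) auto
    then have "{f x} \<in> sets (restrict_space ?L Y0)"
      using fx Y0 by (subst sets_restrict_space_iff) (auto simp: sets.Int_space_eq2)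
    from measurable_sets[OF f this] have "f -` {f x} \<inter> X0 \<in> sets (restrict_space ?N X0)"
      by (simp add: spX0)
    moreover have "f -` {f x} \<inter> X0 = {x}" using gf 2 by auto (metis gf)
    ultimately have "{x} \<in> sets (restrict_space ?N X0)" by simp
    then have "{x} \<in> sets ?N"
      using X0(1) by (subst (asm) sets_restrict_space_iff) auto
    then show ?thesis using R by (auto simp: sets_restrict_space_iff)
  next
    case 3
    have "space ?N - X0 \<in> null_sets M"
      using X0(2) R by (simp add: null_sets_restrict_space)
    then show ?thesis using complete2[of "{x}"] 3 by auto
  qed
qed

text \<open>For each \<open>n\<close>, only finitely many disjoint sets can have measure above
  \<open>1 / (n + 1)\<close>, since their total is bounded by the measure of the space. Every index
  belongs to one of these countably many finite sets.\<close>

lemma (in finite_measure) countable_disjoint_family_pos: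
  assumes meas: "\<And>i. i \<in> I \<Longrightarrow> A i \<in> sets M" and pos: "\<And>i. i \<in> I \<Longrightarrow> measure M (A i) > 0"
    and disj: "disjoint_family_on A I"
  shows "countable I"
proof -
  define J where "J n = {i\<in>I. measure M (A i) > 1 / real (Suc n)}" for n
  have "I \<subseteq> (\<Union>n. J n)"
  proof
    fix i assume i: "i \<in> I"
    from pos[OF i] obtain n where "inverse (real (Suc n)) < measure M (A i)"
      using reals_Archimedean by blast
    then show "i \<in> (\<Union>n. J n)" using i by (auto simp: J_def inverse_eq_divide)
  qed
  moreover have "finite (J n)" for n
  proof (rule ccontr)
    assume inf: "infinite (J n)"
    obtain m :: nat where m: "measure M (space M) * real (Suc n) < real m"
      using reals_Archimedean2 by blast
    from infinite_arbitrarily_large[OF inf] obtain F where F: "finite F" "card F = m" "F \<subseteq> J n"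
      by blast
    have FI: "F \<subseteq> I" using F by (auto simp: J_def)
    have "real m * (1 / real (Suc n)) = (\<Sum>i\<in>F. 1 / real (Suc n))" using F by simp
    also have "\<dots> \<le> (\<Sum>i\<in>F. measure M (A i))"
      by (rule sum_mono) (use F in \<open>auto simp: J_def less_imp_le subset_iff\<close>)
    also have "\<dots> = measure M (\<Union>i\<in>F. A i)"
      by (rule finite_measure_finite_Union[symmetric])
        (use F FI meas disjoint_family_on_mono[OF FI disj] in auto)
    also have "\<dots> \<le> measure M (space M)" by (rule bounded_measure)
    finally show False using m by (simp add: field_simps)
  qed
  ultimately show ?thesis
    by (meson countable_UN countable_finite countable_subset countableI_type)
qed

section \<open>Diameters, essential infima and entropy\<close>

lemma diam_le:
  assumes "\<And>x y. x \<in> A \<Longrightarrow> y \<in> A \<Longrightarrow> \<rho> x y \<le> c"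
  shows "diam \<rho> A \<le> ennreal c"
  unfolding diam_def by (rule SUP_least) (auto intro!: ennreal_leI assms)

text \<open>Every nonzero \<open>z\<close>, infinite or not, lies above some positive real, so it
  suffices to test positive real lower bounds.\<close>

lemma essinf_eq_0_iff:
  "essinf M f = 0 \<longleftrightarrow> (\<forall>e>0. \<not> (AE x in M. ennreal e \<le> f x))"
proof -
  have "essinf M f = 0 \<longleftrightarrow> (\<forall>z. (AE x in M. z \<le> f x) \<longrightarrow> z = 0)"
    unfolding essinf_def bot_ennreal[symmetric] by (simp add: Sup_bot_conv)
  also have "\<dots> \<longleftrightarrow> (\<forall>e>0. \<not> (AE x in M. ennreal e \<le> f x))"
  proof safe
    fix e :: real assume *: "\<forall>z. (AE x in M. z \<le> f x) \<longrightarrow> z = 0" "0 < e" "AE x in M. ennreal e \<le> f x"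
    then have "ennreal e = 0" by blast
    with \<open>0 < e\<close> show False by simp
  next
    fix z assume *: "\<forall>e>0. \<not> (AE x in M. ennreal e \<le> f x)" "AE x in M. z \<le> f x"
    show "z = 0"
    proof (rule ccontr)
      assume "z \<noteq> 0"
      then obtain e where e: "e > 0" "ennreal e < z"
      proof (cases z)
        case (real s)
        then show ?thesis using that[of "s / 2"] \<open>z \<noteq> 0\<close> by (auto simp: ennreal_less_iff)
      next
        case top
        then show ?thesis using that[of 1] by simp
      qed
      have "AE x in M. ennreal e \<le> f x"
        using *(2) by eventually_elim (use e in auto)
      with * e show False by blast
    qed
  qed
  finally show ?thesis .
qed

lemma eps_entropy_finite_iff:
  "eps_entropy \<epsilon> \<rho> M < \<infinity> \<longleftrightarrow> (\<exists>k\<ge>1. entropy_cover M \<rho> \<epsilon> k)"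
  unfolding eps_entropy_def by auto

text \<open>Index 0 of an entropy cover is reserved for the exceptional set. The family is therefore
  renumbered from 1, and whatever it leaves uncovered becomes \<open>X 0\<close>; nonemptiness of
  \<open>F\<close> secures \<open>k \<ge> 1\<close>.\<close>

lemma entropy_cover_finite_family:
  assumes F: "finite F" "F \<noteq> {}" and P: "\<And>d. d \<in> F \<Longrightarrow> P d \<in> sets M"
    and rest: "emeasure M (space M - (\<Union>d\<in>F. P d)) < ennreal \<epsilon>"
    and small: "\<And>d. d \<in> F \<Longrightarrow> diam \<rho> (P d) < ennreal \<epsilon>"
  shows "\<exists>k\<ge>1. entropy_cover M \<rho> \<epsilon> k"
proof -
  obtain h where h: "bij_betw h {1..card F} F"
    using ex_bij_betw_nat_finite_1[OF F(1)] by blast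
  have hF: "h j \<in> F" if "j \<in> {1..card F}" for j using h that by (auto simp: bij_betw_def)
  define X where "X j = (if j = 0 then space M - (\<Union>d\<in>F. P d) else P (h j))" for j
  have "entropy_cover M \<rho> \<epsilon> (card F)"
    unfolding entropy_cover_def
  proof (intro exI[of _ X] conjI allI ballI impI)
    fix j assume "j \<le> card F"
    then show "X j \<in> sets M"
      using P hF[of j] sets.finite_UN[OF F(1) P] by (cases "j = 0") (auto simp: X_def)
  next
    have "{..card F} = insert 0 {1..card F}" by auto
    then have "(\<Union>j\<le>card F. X j) = X 0 \<union> (\<Union>j\<in>{1..card F}. X j)" by simp
    also have "(\<Union>j\<in>{1..card F}. X j) = (\<Union>d\<in>h ` {1..card F}. P d)" by (auto simp: X_def)
    also have "h ` {1..card F} = F" using h by (simp add: bij_betw_def)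
    finally show "(\<Union>j\<le>card F. X j) = space M"
      using sets.sets_into_space[OF P] by (auto simp: X_def)
  next
    show "emeasure M (X 0) < ennreal \<epsilon>" using rest by (simp add: X_def)
  next
    fix j assume "j \<in> {1..card F}"
    then show "diam \<rho> (X j) < ennreal \<epsilon>" using small hF[of j] by (auto simp: X_def)
  qed
  moreover have "card F \<ge> 1" using F by (simp add: Suc_le_eq card_gt_0_iff)
  ultimately show ?thesis by blast
qed

section \<open>Summable semimetrics on a complete probability space\<close>

text \<open>The Lebesgue structure enters the arguments below through completeness and measurable
  singletons.\<close>

locale summable_semimetric_space = prob_space M + complete_measure M
  for M :: "'a measure" +
  fixes \<rho> :: "'a \<Rightarrow> 'a \<Rightarrow> real"
  assumes meas: "measurable_semimetric M \<rho>"
    and summ: "summable_semimetric M \<rho>"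
    and singleton_sets: "x \<in> space M \<Longrightarrow> {x} \<in> sets M"
begin

sublocale square: pair_prob_space M M ..

lemma rho_nonneg: "x \<in> space M \<Longrightarrow> y \<in> space M \<Longrightarrow> 0 \<le> \<rho> x y"
  and rho_refl: "x \<in> space M \<Longrightarrow> \<rho> x x = 0"
  and rho_sym: "x \<in> space M \<Longrightarrow> y \<in> space M \<Longrightarrow> \<rho> x y = \<rho> y x"
  and rho_triangle: "x \<in> space M \<Longrightarrow> y \<in> space M \<Longrightarrow> z \<in> space M \<Longrightarrow> \<rho> x z \<le> \<rho> x y + \<rho> y z"
  using meas unfolding measurable_semimetric_def semimetric_on_def by blast+

section \<open>Sections of the semimetric and almost-everywhere statements on the square\<close>

lemma rho_measurable: "case_prod \<rho> \<in> borel_measurable (completion (M \<Otimes>\<^sub>M M))"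
  using meas unfolding measurable_semimetric_def square_measure_def by blast

text \<open>Fubini arguments are run on a version \<open>r\<close> that is measurable for the
  uncompleted product, and their results are carried back along the almost-everywhere
  equality.\<close>

lemma borel_version:
  obtains r where "r \<in> borel_measurable (M \<Otimes>\<^sub>M M)" "AE p in M \<Otimes>\<^sub>M M. case_prod \<rho> p = r p"
  using completion_ex_borel_measurable_real[OF rho_measurable] by blast

lemma AE_measurable_section: "AE x in M. \<rho> x \<in> borel_measurable M"
proof -
  obtain r where r: "r \<in> borel_measurable (M \<Otimes>\<^sub>M M)" "AE p in M \<Otimes>\<^sub>M M. case_prod \<rho> p = r p"
    by (rule borel_version)
  have "AE x in M. AE y in M. case_prod \<rho> (x, y) = r (x, y)"
    by (rule square.AE_pair) (rule r)
  then show ?thesis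
    using AE_space
  proof eventually_elim
    case (elim x)
    show ?case
    proof (rule borel_measurable_AE_eq)
      show "(\<lambda>y. r (x, y)) \<in> borel_measurable M"
        using r(1) elim(2) by (rule measurable_Pair2)
      show "AE y in M. \<rho> x y = r (x, y)" using elim(1) by simp
    qed simp
  qed
qed

text \<open>Integrability passes from \<open>\<rho>\<close> to \<open>r\<close>, from the completed
  to the plain product, and by Fubini to almost every section of \<open>r\<close>; almost every
  section of \<open>\<rho>\<close> agrees with it almost everywhere.\<close>

lemma AE_integrable_section: "AE x in M. integrable M (\<rho> x)"
proof -
  obtain r where r: "r \<in> borel_measurable (M \<Otimes>\<^sub>M M)" "AE p in M \<Otimes>\<^sub>M M. case_prod \<rho> p = r p"
    by (rule borel_version)
  have "integrable (completion (M \<Otimes>\<^sub>M M)) (case_prod \<rho>)"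
    using summ by (simp add: summable_semimetric_def square_measure_def)
  then have "integrable (completion (M \<Otimes>\<^sub>M M)) r"
    using r rho_measurable
    by (subst integrable_cong_AE[where g = "case_prod \<rho>"])
      (auto intro: measurable_completion AE_completion elim: AE_mp)
  then have "integrable (M \<Otimes>\<^sub>M M) r" using r(1) by (simp add: integrable_completion)
  from square.AE_integrable_fst'[OF this]
  have int: "AE x in M. integrable M (\<lambda>y. r (x, y))" .
  have "AE x in M. AE y in M. case_prod \<rho> (x, y) = r (x, y)"
    by (rule square.AE_pair) (rule r)
  then show ?thesis
    using int AE_measurable_section
  proof eventually_elim
    case (elim x)
    then show ?case
      by (subst integrable_cong_AE[where g = "\<lambda>y. r (x, y)"]) auto
  qed
qed

lemma semimetric_ball_sets:
  assumes "\<rho> x \<in> borel_measurable M"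
  shows "semimetric_ball M \<rho> x e \<in> sets M"
  unfolding semimetric_ball_def using assms by measurable

text \<open>Completion does not change which properties hold almost everywhere. Essential suprema
  and infima over \<open>A \<times> A\<close> thereby become accessible to Fubini.\<close>

lemma AE_restrict_square_iff:
  assumes "A \<in> sets M"
  shows "(AE p in restrict_space (square_measure M) (A \<times> A). P p) \<longleftrightarrow>
    (AE p in M \<Otimes>\<^sub>M M. p \<in> A \<times> A \<longrightarrow> P p)"
proof -
  have "A \<times> A \<in> sets (M \<Otimes>\<^sub>M M)" using assms by auto
  then have "A \<times> A \<inter> space (square_measure M) \<in> sets (square_measure M)"
    unfolding square_measure_def by (auto intro!: sets.Int)
  then show ?thesis
    by (simp only: AE_restrict_space_iff) (simp only: square_measure_def AE_completion_iff)
qed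

text \<open>The dense set of \<open>X\<close> may miss \<open>Y\<close>. For each dense point
  \<open>d\<close> and each scale \<open>1 / (n + 1)\<close> at which some point of \<open>Y\<close>
  is near \<open>d\<close>, one such point is chosen; the triangle inequality makes the chosen
  points dense in \<open>Y\<close>.\<close>

lemma separable_on_subset:
  assumes sep: "separable_on X \<rho>" and X: "X \<subseteq> space M" and Y: "Y \<subseteq> X"
  shows "separable_on Y \<rho>"
proof -
  obtain D where D: "D \<subseteq> X" "countable D" and dense: "\<And>x e. x \<in> X \<Longrightarrow> e > 0 \<Longrightarrow> \<exists>d\<in>D. \<rho> x d < e"
    using sep unfolding separable_on_def by blast
  define Q where "Q = {(d, n) \<in> D \<times> (UNIV :: nat set). \<exists>y\<in>Y. \<rho> y d < 1 / real (Suc n)}"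
  have "\<forall>q\<in>Q. \<exists>y. y \<in> Y \<and> \<rho> y (fst q) < 1 / real (Suc (snd q))"
    unfolding Q_def by auto
  from bchoice[OF this] obtain c
    where "\<forall>q\<in>Q. c q \<in> Y \<and> \<rho> (c q) (fst q) < 1 / real (Suc (snd q))" ..
  then have c: "c (d, n) \<in> Y \<and> \<rho> (c (d, n)) d < 1 / real (Suc n)" if "(d, n) \<in> Q" for d n
    using that by force
  have "countable Q"
    by (rule countable_subset[of _ "D \<times> UNIV"]) (use D in \<open>auto simp: Q_def\<close>)
  moreover have "c ` Q \<subseteq> Y" using c by auto
  moreover have "\<exists>z\<in>c ` Q. \<rho> y z < e" if y: "y \<in> Y" and e: "e > 0" for y e
  proof -
    obtain n where n: "inverse (real (Suc n)) < e / 2" using reals_Archimedean[of "e / 2"] e by auto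
    obtain d where d: "d \<in> D" "\<rho> y d < 1 / real (Suc n)"
      using dense[of y "1 / real (Suc n)"] y Y by auto
    then have q: "(d, n) \<in> Q" using y by (auto simp: Q_def)
    have "\<rho> y (c (d, n)) \<le> \<rho> y d + \<rho> d (c (d, n))"
      by (rule rho_triangle) (use y Y X d D c[OF q] in auto)
    also have "\<rho> d (c (d, n)) = \<rho> (c (d, n)) d"
      by (rule rho_sym) (use Y X d D c[OF q] in auto)
    also have "\<rho> y d + \<rho> (c (d, n)) d < e"
      using c[OF q] d n by (simp add: inverse_eq_divide)
    finally show ?thesis using q by blast
  qed
  ultimately show ?thesis
    unfolding separable_on_def by (intro exI[of _ "c ` Q"]) auto
qed

section \<open>From separability to approximation by finitely supported measures\<close>

text \<open>The approximating measure is the image of \<mu> under a map \<open>T\<close> with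
  finitely many values, and the plan is carried by the graph of \<open>T\<close>. Its cost is at
  most \<open>e\<close> plus the integral of \<open>\<rho> (d 0)\<close> over the bad set
  \<open>R n\<close>.\<close>

lemma admissible_imp_kantorovich:
  assumes adm: "admissible_semimetric M \<rho>" and \<epsilon>: "\<epsilon> > 0"
  shows "\<exists>\<nu>. prob_space \<nu> \<and> sets \<nu> = sets M \<and> finitely_supported \<nu> \<and>
    kantorovich \<rho> M \<nu> < ennreal \<epsilon>"
proof -
  obtain X1 where X1: "X1 \<in> sets M" "space M - X1 \<in> null_sets M" "separable_on X1 \<rho>"
    using adm unfolding admissible_semimetric_def by blast
  have "AE x in M. \<rho> x \<in> borel_measurable M \<and> integrable M (\<rho> x) \<and> x \<in> X1"
    using AE_measurable_section AE_integrable_section AE_not_in[OF X1(2)] AE_space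
    by eventually_elim auto
  then obtain N where N: "N \<in> null_sets M"
    "{x\<in>space M. \<not> (\<rho> x \<in> borel_measurable M \<and> integrable M (\<rho> x) \<and> x \<in> X1)} \<subseteq> N"
    unfolding eventually_ae_filter by blast
  \<comment> \<open>The dense points are drawn from \<open>G\<close>, because the distance functions
    to them must be measurable and integrable.\<close>
  define G where "G = space M - N"
  have G: "G \<subseteq> X1" "G \<subseteq> space M" and
    G_int: "\<And>x. x \<in> G \<Longrightarrow> \<rho> x \<in> borel_measurable M \<and> integrable M (\<rho> x)"
    using N by (auto simp: G_def)
  have AE_G: "AE x in M. x \<in> G"
    using AE_not_in[OF N(1)] AE_space by eventually_elim (auto simp: G_def)
  have "separable_on G \<rho>"
    using separable_on_subset X1 G sets.sets_into_space by blast
  then obtain D where D: "D \<subseteq> G" "countable D"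
    and dense: "\<And>x e. x \<in> G \<Longrightarrow> e > 0 \<Longrightarrow> \<exists>d\<in>D. \<rho> x d < e"
    unfolding separable_on_def by blast
  have "G \<noteq> {}" using AE_G AE_False by fastforce
  then have "D \<noteq> {}" using dense[of _ 1] by force
  define d where "d = from_nat_into D"
  have rd: "range d = D" unfolding d_def by (rule range_from_nat_into) fact+
  then have dG: "d i \<in> G" for i using D by auto
  then have dM: "d i \<in> space M" for i using G by auto
  have [measurable]: "\<rho> (d i) \<in> borel_measurable M" for i using dG G_int by blast
  \<comment> \<open>One third pays for points moved by less than \<open>e\<close>, one third for the
    bad set, and the last keeps the final inequality strict.\<close>
  define e where "e = \<epsilon> / 3"
  have e: "e > 0" using \<epsilon> by (simp add: e_def)
  define R where "R n = {x\<in>space M. \<forall>i<n. e \<le> \<rho> (d i) x}" for n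
  have R[measurable]: "R n \<in> sets M" for n unfolding R_def by measurable
  \<comment> \<open>The sets \<open>R n\<close> decrease to a set disjoint from \<open>G\<close>,
    hence null. The dominating function is the distance to \<open>d 0\<close>, the point to which
    the bad set is sent.\<close>
  have "(\<lambda>n. \<integral>\<^sup>+x. indicator (R n) x * ennreal (\<rho> (d 0) x) \<partial>M) \<longlonglongrightarrow> (\<integral>\<^sup>+x. 0 \<partial>M)"
  proof (rule nn_integral_dominated_convergence)
    show "AE x in M. indicator (R n) x * ennreal (\<rho> (d 0) x) \<le> ennreal (\<rho> (d 0) x)" for n
      by (intro AE_I2) (simp split: split_indicator)
    have "integrable M (\<rho> (d 0))" using G_int dG by blast
    then have "(\<integral>\<^sup>+x. ennreal (norm (\<rho> (d 0) x)) \<partial>M) < \<infinity>"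
      by (simp add: integrable_iff_bounded)
    moreover have "(\<integral>\<^sup>+x. ennreal (norm (\<rho> (d 0) x)) \<partial>M) = (\<integral>\<^sup>+x. ennreal (\<rho> (d 0) x) \<partial>M)"
      by (rule nn_integral_cong) (use rho_nonneg dM in simp)
    ultimately show "(\<integral>\<^sup>+x. ennreal (\<rho> (d 0) x) \<partial>M) < \<infinity>" by simp
    show "AE x in M. (\<lambda>n. indicator (R n) x * ennreal (\<rho> (d 0) x)) \<longlonglongrightarrow> 0"
      using AE_G
    proof eventually_elim
      case (elim x)
      obtain i where "\<rho> x (d i) < e" using dense[OF elim e] rd by blast
      then have "\<rho> (d i) x < e" using rho_sym[of x "d i"] elim G dM by auto
      then have "x \<notin> R n" if "n \<ge> Suc i" for n
        using that by (auto simp: R_def not_le intro!: exI[of _ i])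
      then have "eventually (\<lambda>n. indicator (R n) x * ennreal (\<rho> (d 0) x) = 0) sequentially"
        by (intro eventually_sequentiallyI[of "Suc i"]) auto
      then show ?case by (rule tendsto_eventually)
    qed
  qed simp_all
  then have "eventually (\<lambda>n. (\<integral>\<^sup>+x. indicator (R n) x * ennreal (\<rho> (d 0) x) \<partial>M) < ennreal e) sequentially"
    by (rule order_tendstoD) (use e in simp)
  then obtain n where n: "(\<integral>\<^sup>+x. indicator (R n) x * ennreal (\<rho> (d 0) x) \<partial>M) < ennreal e"
    by (auto simp: eventually_sequentially)
  \<comment> \<open>Index \<open>n\<close> is the default with \<open>w n = d 0\<close>. On
    \<open>space M\<close>, the least index in \<open>T\<close> equals \<open>n\<close> exactly when
    \<open>x\<close> lies in \<open>R n\<close>.\<close>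
  define w where "w i = (if i < n then d i else d 0)" for i
  define T where "T x = w (LEAST i. i = n \<or> \<rho> (d i) x < e)" for x
  have [measurable]: "w \<in> count_space UNIV \<rightarrow>\<^sub>M M" using dM by (auto simp: w_def)
  have T[measurable]: "T \<in> M \<rightarrow>\<^sub>M M" unfolding T_def by measurable
  define F where "F = w ` {..n}"
  have F: "finite F" "F \<subseteq> range d" by (auto simp: F_def w_def)
  have TF: "T x \<in> F" for x
    unfolding T_def F_def by (intro imageI) (auto intro: Least_le)
  have F_sets: "F \<in> sets M"
  proof -
    have "(\<Union>y\<in>F. {y}) \<in> sets M"
      by (rule sets.finite_UN) (use F dM singleton_sets in auto)
    then show ?thesis by simp
  qed
  have T_close: "ennreal (\<rho> (T x) x) \<le> ennreal e + indicator (R n) x * ennreal (\<rho> (d 0) x)"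
    if x: "x \<in> space M" for x
  proof -
    define k where "k = (LEAST i. i = n \<or> \<rho> (d i) x < e)"
    have k: "k = n \<or> \<rho> (d k) x < e"
      unfolding k_def by (rule LeastI[of "\<lambda>i. i = n \<or> \<rho> (d i) x < e" n]) simp
    have "k \<le> n" unfolding k_def by (rule Least_le) simp
    have Tx: "T x = w k" by (simp add: T_def k_def)
    show ?thesis
    proof (cases "k = n")
      case True
      have "e \<le> \<rho> (d i) x" if "i < n" for i
        using not_less_Least[of i "\<lambda>i. i = n \<or> \<rho> (d i) x < e"] that True
        unfolding k_def by auto
      then have "x \<in> R n" using x by (auto simp: R_def)
      then show ?thesis using True Tx by (simp add: w_def)
    next
      case False
      then have "ennreal (\<rho> (T x) x) \<le> ennreal e"
        using k Tx \<open>k \<le> n\<close> by (auto simp: w_def intro!: ennreal_leI)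
      then show ?thesis by (rule order_trans) simp
    qed
  qed
  define \<nu> where "\<nu> = distr M M T"
  define \<Psi> where "\<Psi> = distr M (M \<Otimes>\<^sub>M M) (\<lambda>x. (x, T x))"
  have sets_\<nu>: "sets \<nu> = sets M" and space_\<nu>: "space \<nu> = space M" by (simp_all add: \<nu>_def)
  have \<nu>: "prob_space \<nu>" unfolding \<nu>_def by (rule prob_space_distr) simp
  have fs: "finitely_supported \<nu>"
    unfolding finitely_supported_def
  proof (intro bexI conjI)
    show "finite F" by fact
    show "F \<in> sets \<nu>" using F_sets sets_\<nu> by simp
    have "T -` (space M - F) \<inter> space M = {}" using TF by auto
    then have "emeasure \<nu> (space M - F) = 0"
      unfolding \<nu>_def using F_sets by (subst emeasure_distr) auto
    then show "space \<nu> - F \<in> null_sets \<nu>"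
      using F_sets by (intro null_setsI) (auto simp: space_\<nu> sets_\<nu>)
  qed
  have coup: "\<Psi> \<in> couplings M \<nu>"
    unfolding couplings_def
  proof (intro CollectI conjI)
    show "prob_space \<Psi>" unfolding \<Psi>_def by (rule prob_space_distr) simp
    show "sets \<Psi> = sets (M \<Otimes>\<^sub>M \<nu>)"
      unfolding \<Psi>_def sets_distr by (rule sets_pair_measure_cong[OF refl sets_\<nu>, symmetric])
    have "distr \<Psi> M fst = distr M M (\<lambda>x. x)"
      unfolding \<Psi>_def by (subst distr_distr) (auto simp: comp_def)
    then show "distr \<Psi> M fst = M" by (simp add: distr_id2)
    have "distr \<Psi> \<nu> snd = distr \<Psi> M snd"
      by (rule distr_cong) (auto simp: sets_\<nu>)
    also have "\<dots> = \<nu>"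
      unfolding \<Psi>_def \<nu>_def by (subst distr_distr) (auto simp: comp_def)
    finally show "distr \<Psi> \<nu> snd = \<nu>" .
  qed
  \<comment> \<open>\<open>\<rho>\<close> itself need not be measurable for \<open>\<Psi>\<close>; but \<open>\<Psi>\<close> is carried by \<open>X \<times> F\<close>, where \<open>\<rho>\<close> agrees with
    a combination of measurable sections.\<close>
  define g where "g p = (\<Sum>y\<in>F. \<rho> y (fst p) * indicator {y} (snd p))" for p
  have F_meas: "\<rho> y \<in> borel_measurable M" "{y} \<in> sets M" if "y \<in> F" for y
    using that F dM dG G_int singleton_sets by blast+
  have g[measurable]: "g \<in> borel_measurable (M \<Otimes>\<^sub>M M)"
    unfolding g_def
  proof (rule borel_measurable_sum)
    fix y assume "y \<in> F"
    note [measurable] = F_meas[OF this]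
    show "(\<lambda>p. \<rho> y (fst p) * indicator {y} (snd p)) \<in> borel_measurable (M \<Otimes>\<^sub>M M)"
      by measurable
  qed
  have g_eq: "g (x, y) = \<rho> y x" if "y \<in> F" for x y
  proof -
    have "g (x, y) = (\<Sum>z\<in>F. if z = y then \<rho> z x else 0)"
      unfolding g_def by (rule sum.cong) (auto split: split_indicator)
    then show ?thesis using that F by simp
  qed
  have sets_\<Psi>: "sets \<Psi> = sets (M \<Otimes>\<^sub>M M)" and space_\<Psi>: "space \<Psi> = space M \<times> space M"
    by (auto simp: \<Psi>_def space_pair_measure)
  have "AE p in \<Psi>. snd p \<in> F"
    unfolding \<Psi>_def using F_sets TF
    by (subst AE_distr_iff) (auto intro!: measurable_sets_Collect)
  then have ae: "AE p in \<Psi>. case_prod \<rho> p = g p"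
    using AE_space
  proof eventually_elim
    case (elim p)
    then show ?case using g_eq rho_sym by (cases p) (auto simp: space_\<Psi>)
  qed
  have cmeas: "case_prod \<rho> \<in> borel_measurable (completion \<Psi>)"
  proof (rule completion.borel_measurable_AE_eq)
    show "g \<in> borel_measurable (completion \<Psi>)"
      by (rule measurable_completion) (use g sets_\<Psi> in \<open>simp cong: measurable_cong_sets\<close>)
  qed (use ae in \<open>auto intro: AE_completion\<close>)
  have "kantorovich \<rho> M \<nu> \<le> (\<integral>\<^sup>+p. ennreal (case_prod \<rho> p) \<partial>completion \<Psi>)"
    unfolding kantorovich_def by (rule INF_lower) (use coup cmeas in auto)
  also have "\<dots> = (\<integral>\<^sup>+p. ennreal (g p) \<partial>\<Psi>)"
    unfolding nn_integral_completion
    by (rule nn_integral_cong_AE) (use ae in \<open>eventually_elim, simp\<close>)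
  also have "\<dots> = (\<integral>\<^sup>+x. ennreal (g (x, T x)) \<partial>M)"
    unfolding \<Psi>_def by (rule nn_integral_distr) auto
  also have "\<dots> = (\<integral>\<^sup>+x. ennreal (\<rho> (T x) x) \<partial>M)" using g_eq TF by simp
  also have "\<dots> \<le> (\<integral>\<^sup>+x. ennreal e + indicator (R n) x * ennreal (\<rho> (d 0) x) \<partial>M)"
    by (rule nn_integral_mono) (rule T_close)
  also have "\<dots> = ennreal e + (\<integral>\<^sup>+x. indicator (R n) x * ennreal (\<rho> (d 0) x) \<partial>M)"
    by (subst nn_integral_add) (auto simp: emeasure_space_1)
  also have "\<dots> \<le> ennreal e + ennreal e" using n by (intro add_left_mono) simp
  also have "\<dots> = ennreal (2 * e)" using e by (simp flip: ennreal_plus)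
  also have "\<dots> < ennreal \<epsilon>" using \<epsilon> by (intro ennreal_lessI) (auto simp: e_def)
  finally show ?thesis using \<nu> sets_\<nu> fs by blast
qed

section \<open>From cheap transport onto a finite set to finite entropy\<close>

text \<open>The first marginal of the plan is \<mu> and the second charges only \<open>F\<close>.
  Hence the measure of the points lying in no section \<open>P y\<close> is bounded by the mass of
  the plan outside \<open>S'\<close>.\<close>

lemma kantorovich_imp_entropy_cover:
  assumes K: "\<And>\<epsilon>. \<epsilon> > 0 \<Longrightarrow> \<exists>\<nu>. prob_space \<nu> \<and> sets \<nu> = sets M \<and> finitely_supported \<nu> \<and>
    kantorovich \<rho> M \<nu> < ennreal \<epsilon>" and \<epsilon>: "\<epsilon> > 0"
  shows "\<exists>k\<ge>1. entropy_cover M \<rho> \<epsilon> k"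
proof -
  define e where "e = \<epsilon> / 3"
  have e: "e > 0" using \<epsilon> by (simp add: e_def)
  \<comment> \<open>With cost below \<open>e * e\<close>, Markov's inequality at level
    \<open>e\<close> leaves mass below \<open>e\<close> where \<open>\<rho>\<close> is at least
    \<open>e\<close>.\<close>
  obtain \<nu> where \<nu>: "prob_space \<nu>" "sets \<nu> = sets M" "finitely_supported \<nu>"
    "kantorovich \<rho> M \<nu> < ennreal (e * e)"
    using K[of "e * e"] e by auto
  then obtain \<Psi> where \<Psi>: "\<Psi> \<in> couplings M \<nu>"
    and cmeas: "case_prod \<rho> \<in> borel_measurable (completion \<Psi>)"
    and cost: "(\<integral>\<^sup>+p. ennreal (case_prod \<rho> p) \<partial>completion \<Psi>) < ennreal (e * e)"
    unfolding kantorovich_def by (auto simp: INF_less_iff)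
  obtain F where F: "F \<in> sets M" "finite F" "space M - F \<in> null_sets \<nu>"
    using \<nu> sets_eq_imp_space_eq[OF \<nu>(2)] unfolding finitely_supported_def by auto
  have sets_\<Psi>: "sets \<Psi> = sets (M \<Otimes>\<^sub>M M)"
    and d1: "distr \<Psi> M fst = M" and d2: "distr \<Psi> \<nu> snd = \<nu>"
    using \<Psi> sets_pair_measure_cong[OF refl \<nu>(2)] unfolding couplings_def by auto
  interpret \<Psi>: prob_space \<Psi> using \<Psi> by (simp add: couplings_def)
  have space_\<Psi>: "space \<Psi> = space M \<times> space M"
    using sets_eq_imp_space_eq[OF sets_\<Psi>] by (simp add: space_pair_measure)
  have fst_m: "fst \<in> \<Psi> \<rightarrow>\<^sub>M M" and snd_m: "snd \<in> \<Psi> \<rightarrow>\<^sub>M \<nu>"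
    using sets_\<Psi> \<nu>(2) by (simp_all cong: measurable_cong_sets)
  define B where "B = {p\<in>space (completion \<Psi>). e \<le> case_prod \<rho> p}"
  define S where "S = {p\<in>space (completion \<Psi>). case_prod \<rho> p < e}"
  \<comment> \<open>Passing to the main part makes the sections at the points of \<open>F\<close> measurable.\<close>
  define S' where "S' = main_part \<Psi> S"
  have B: "B \<in> sets (completion \<Psi>)" unfolding B_def using cmeas by measurable
  have S: "S \<in> sets (completion \<Psi>)" unfolding S_def using cmeas by measurable
  have S': "S' \<in> sets \<Psi>" "S' \<subseteq> S"
    unfolding S'_def using S main_part_null_part_Un[OF S] by (simp, blast)
  have "ennreal e * emeasure (completion \<Psi>) B \<le> (\<integral>\<^sup>+p. ennreal (case_prod \<rho> p) \<partial>completion \<Psi>)"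
  proof -
    have "ennreal e * emeasure (completion \<Psi>) B = (\<integral>\<^sup>+p. ennreal e * indicator B p \<partial>completion \<Psi>)"
      using B by (simp add: nn_integral_cmult_indicator)
    also have "\<dots> \<le> (\<integral>\<^sup>+p. ennreal (case_prod \<rho> p) \<partial>completion \<Psi>)"
      by (rule nn_integral_mono) (auto simp: B_def split: split_indicator intro!: ennreal_leI)
    finally show ?thesis .
  qed
  also note cost
  finally have "ennreal e * emeasure (completion \<Psi>) B < ennreal e * ennreal e"
    using e by (simp add: ennreal_mult')
  \<comment> \<open>Were the measure of \<open>B\<close> at least \<open>e\<close>, multiplying by
    \<open>e\<close> would contradict the strict bound just obtained.\<close>
  then have B_small: "emeasure (completion \<Psi>) B < ennreal e"
    using mult_left_mono[of "ennreal e" "emeasure (completion \<Psi>) B" "ennreal e"]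
    by (intro notI[where P = "ennreal e \<le> _", unfolded not_le]) simp
  have "emeasure \<Psi> (space \<Psi> - S') < ennreal e"
  proof -
    have "emeasure \<Psi> (space \<Psi> - S') = emeasure (completion \<Psi>) (space \<Psi> - S')"
      using S' by simp
    also have "\<dots> = emeasure (completion \<Psi>) B"
    proof (rule emeasure_eq_AE)
      have "AE p in completion \<Psi>. p \<in> S' \<longleftrightarrow> p \<in> S"
        unfolding S'_def by (rule AE_completion[OF AE_in_main_part[OF S]])
      then show "AE p in completion \<Psi>. p \<in> space \<Psi> - S' \<longleftrightarrow> p \<in> B"
        using AE_space by eventually_elim (auto simp: B_def S_def)
    qed (use B S' in auto)
    also note B_small
    finally show ?thesis .
  qed
  define P where "P y = {x\<in>space M. (x, y) \<in> S'}" for y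
  have FM: "F \<subseteq> space M" using F(1) sets.sets_into_space by blast
  have P_sets: "P y \<in> sets M" if "y \<in> F" for y
  proof -
    have "(\<lambda>x. (x, y)) -` S' \<inter> space M \<in> sets M"
      by (rule measurable_sets[where A = "M \<Otimes>\<^sub>M M"]) (use that FM S' sets_\<Psi> in auto)
    also have "(\<lambda>x. (x, y)) -` S' \<inter> space M = P y" by (auto simp: P_def)
    finally show ?thesis .
  qed
  have P_diam: "diam \<rho> (P y) < ennreal \<epsilon>" if y: "y \<in> F" for y
  proof -
    have "diam \<rho> (P y) \<le> ennreal (2 * e)"
    proof (rule diam_le)
      fix a b assume ab: "a \<in> P y" "b \<in> P y"
      then have "a \<in> space M" "b \<in> space M" "\<rho> a y < e" "\<rho> b y < e"
        using S'(2) by (auto simp: P_def S_def)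
      moreover have "y \<in> space M" using y FM by auto
      ultimately show "\<rho> a b \<le> 2 * e"
        using rho_triangle[of a y b] rho_sym[of y b] by simp
    qed
    also have "\<dots> < ennreal \<epsilon>" using \<epsilon> by (intro ennreal_lessI) (auto simp: e_def)
    finally show ?thesis .
  qed
  have rest: "emeasure M (space M - (\<Union>y\<in>F. P y)) < ennreal \<epsilon>"
  proof -
    let ?W = "space M - (\<Union>y\<in>F. P y)"
    have W: "?W \<in> sets M" using sets.finite_UN[OF F(2) P_sets] by auto
    have V: "snd -` (space M - F) \<inter> space \<Psi> \<in> null_sets \<Psi>"
    proof (rule null_setsI)
      show "snd -` (space M - F) \<inter> space \<Psi> \<in> sets \<Psi>"
        by (rule measurable_sets[OF snd_m]) (use F in auto)
      have "emeasure \<Psi> (snd -` (space M - F) \<inter> space \<Psi>) = emeasure (distr \<Psi> \<nu> snd) (space M - F)"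
        by (rule emeasure_distr[symmetric]) (use F snd_m in auto)
      also have "\<dots> = 0" using F(3) d2 by auto
      finally show "emeasure \<Psi> (snd -` (space M - F) \<inter> space \<Psi>) = 0" .
    qed
    have "emeasure M ?W = emeasure (distr \<Psi> M fst) ?W" by (simp add: d1)
    also have "\<dots> = emeasure \<Psi> (fst -` ?W \<inter> space \<Psi>)"
      by (rule emeasure_distr) (use fst_m W in auto)
    \<comment> \<open>A pair whose first coordinate avoids every \<open>P y\<close> either lies
      outside \<open>S'\<close> or has its second coordinate outside \<open>F\<close>.\<close>
    also have "\<dots> \<le> emeasure \<Psi> ((space \<Psi> - S') \<union> (snd -` (space M - F) \<inter> space \<Psi>))"
    proof (rule emeasure_mono)
      show "fst -` ?W \<inter> space \<Psi> \<subseteq> (space \<Psi> - S') \<union> (snd -` (space M - F) \<inter> space \<Psi>)"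
        by (auto simp: P_def space_\<Psi>)
      show "(space \<Psi> - S') \<union> (snd -` (space M - F) \<inter> space \<Psi>) \<in> sets \<Psi>"
        using S' null_setsD2[OF V] by (intro sets.Un) auto
    qed
    also have "\<dots> = emeasure \<Psi> (space \<Psi> - S')"
      using S' V by (intro emeasure_Un_null_set) auto
    also have "\<dots> < ennreal e" by fact
    also have "\<dots> \<le> ennreal \<epsilon>" using \<epsilon> by (intro ennreal_leI) (simp add: e_def)
    finally show ?thesis .
  qed
  have "F \<noteq> {}"
  proof
    assume "F = {}"
    then have "emeasure \<nu> (space \<nu>) = 0"
      using F(3) sets_eq_imp_space_eq[OF \<nu>(2)] by auto
    then show False using prob_space.emeasure_space_1[OF \<nu>(1)] by simp
  qed
  then show ?thesis
    using entropy_cover_finite_family[where F = F and P = P] F(2) P_sets rest P_diam by blast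
qed

section \<open>From diameters to essential diameters and essential infima\<close>

text \<open>An essential diameter never exceeds the diameter, so the same cover serves.\<close>

lemma entropy_cover_imp_essdiam_cover:
  assumes "entropy_cover M \<rho> \<epsilon> k"
  shows "\<exists>k. \<exists>X::nat \<Rightarrow> 'a set. (\<forall>j\<le>k. X j \<in> sets M) \<and> (\<Union>j\<le>k. X j) = space M \<and>
    emeasure M (X 0) < ennreal \<epsilon> \<and> (\<forall>j\<in>{1..k}. essdiam M \<rho> (X j) < ennreal \<epsilon>)"
proof -
  have "essdiam M \<rho> A \<le> diam \<rho> A" for A
    unfolding essdiam_def
  proof (rule esssup_I)
    show "(\<lambda>p. ennreal (case_prod \<rho> p)) \<in> borel_measurable (restrict_space (square_measure M) (A \<times> A))"
      using rho_measurable
      by (intro measurable_restrict_space1 measurable_compose[OF _ measurable_ennreal])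
        (simp add: square_measure_def)
    show "AE p in restrict_space (square_measure M) (A \<times> A). ennreal (case_prod \<rho> p) \<le> diam \<rho> A"
      unfolding diam_def by (intro AE_I2 SUP_upper) (simp add: space_restrict_space)
  qed
  then show ?thesis
    using assms unfolding entropy_cover_def by (meson le_less_trans)
qed

lemma essdiam_cover_imp_essinf:
  assumes cover: "\<And>\<epsilon>. \<epsilon> > 0 \<Longrightarrow>
      \<exists>k. \<exists>X::nat \<Rightarrow> 'a set. (\<forall>j\<le>k. X j \<in> sets M) \<and> (\<Union>j\<le>k. X j) = space M \<and>
        emeasure M (X 0) < ennreal \<epsilon> \<and> (\<forall>j\<in>{1..k}. essdiam M \<rho> (X j) < ennreal \<epsilon>)"
    and A: "A \<in> sets M" "emeasure M A > 0"
  shows "essinf (restrict_space (square_measure M) (A \<times> A)) (\<lambda>p. ennreal (case_prod \<rho> p)) = 0"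
  unfolding essinf_eq_0_iff
proof (intro allI impI notI)
  fix e :: real assume e: "e > 0"
    and ge: "AE p in restrict_space (square_measure M) (A \<times> A). ennreal e \<le> ennreal (case_prod \<rho> p)"
  have mA: "measure M A > 0" using A(2) by (simp add: emeasure_eq_measure)
  \<comment> \<open>The bound by \<open>e\<close> forces each piece \<open>A \<inter> X j\<close>
    with \<open>j \<ge> 1\<close> to be null; the bound by the measure of \<open>A\<close> then
    prevents \<open>X 0\<close> from covering the rest.\<close>
  define \<epsilon> where "\<epsilon> = min e (measure M A)"
  have "\<epsilon> > 0" using e mA by (simp add: \<epsilon>_def)
  from cover[OF this] obtain k and X :: "nat \<Rightarrow> 'a set" where
    "\<forall>j\<le>k. X j \<in> sets M" "(\<Union>j\<le>k. X j) = space M" "emeasure M (X 0) < ennreal \<epsilon>"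
      "\<forall>j\<in>{1..k}. essdiam M \<rho> (X j) < ennreal \<epsilon>"
    by (elim exE conjE)
  then have X: "\<And>j. j \<le> k \<Longrightarrow> X j \<in> sets M" "(\<Union>j\<le>k. X j) = space M"
      "emeasure M (X 0) < ennreal \<epsilon>" "\<And>j. j \<in> {1..k} \<Longrightarrow> essdiam M \<rho> (X j) < ennreal \<epsilon>"
    by blast+
  have null: "A \<inter> X j \<in> null_sets M" if j: "j \<in> {1..k}" for j
  proof -
    let ?B = "A \<inter> X j"
    have Xj: "X j \<in> sets M" using X(1) j by simp
    have B: "?B \<in> sets M" using A Xj by auto
    have "AE p in restrict_space (square_measure M) (X j \<times> X j).
        ennreal (case_prod \<rho> p) \<le> essdiam M \<rho> (X j)"
      unfolding essdiam_def by (rule esssup_AE)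
    then have "AE p in M \<Otimes>\<^sub>M M. p \<in> X j \<times> X j \<longrightarrow> ennreal (case_prod \<rho> p) \<le> essdiam M \<rho> (X j)"
      using AE_restrict_square_iff[OF Xj] by simp
    moreover have "AE p in M \<Otimes>\<^sub>M M. p \<in> A \<times> A \<longrightarrow> ennreal e \<le> ennreal (case_prod \<rho> p)"
      using ge AE_restrict_square_iff[OF A(1)] by simp
    \<comment> \<open>On the square of \<open>?B\<close> the values of \<open>\<rho>\<close> would
      be almost everywhere both at least and below \<open>e\<close>, so that square is null, and
      with it \<open>?B\<close>.\<close>
    ultimately have "AE p in M \<Otimes>\<^sub>M M. p \<notin> ?B \<times> ?B"
    proof eventually_elim
      case (elim p)
      have "essdiam M \<rho> (X j) < ennreal e"
        using X(4)[OF j] by (rule less_le_trans) (auto simp: \<epsilon>_def intro!: ennreal_leI)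
      then show ?case using elim by (auto simp: not_le[symmetric])
    qed
    then have "emeasure (M \<Otimes>\<^sub>M M) (?B \<times> ?B) = 0"
      using B by (subst (asm) AE_iff_measurable[where N = "?B \<times> ?B"])
        (use sets.sets_into_space[OF B] in \<open>auto simp: space_pair_measure\<close>)
    then have "emeasure M ?B * emeasure M ?B = 0"
      using B by (simp add: emeasure_pair_measure_Times)
    then show ?thesis using B by (auto simp: null_sets_def)
  qed
  have "(\<Union>j\<in>{1..k}. A \<inter> X j) \<in> null_sets M"
    by (rule null_sets_UN') (use null in auto)
  then have "emeasure M (X 0 \<union> (\<Union>j\<in>{1..k}. A \<inter> X j)) = emeasure M (X 0)"
    using X(1)[of 0] by (intro emeasure_Un_null_set) auto
  moreover have "A \<subseteq> X 0 \<union> (\<Union>j\<in>{1..k}. A \<inter> X j)"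
  proof
    fix x assume x: "x \<in> A"
    then have "x \<in> (\<Union>j\<le>k. X j)" using A(1) sets.sets_into_space X(2) by blast
    then obtain j where "j \<le> k" "x \<in> X j" by blast
    then show "x \<in> X 0 \<union> (\<Union>j\<in>{1..k}. A \<inter> X j)" using x by (cases "j = 0") auto
  qed
  ultimately have "emeasure M A \<le> emeasure M (X 0)"
    using emeasure_mono[of A "X 0 \<union> (\<Union>j\<in>{1..k}. A \<inter> X j)" M]
      X(1)[of 0] \<open>(\<Union>j\<in>{1..k}. A \<inter> X j) \<in> null_sets M\<close> by auto
  also have "\<dots> < ennreal \<epsilon>" by fact
  also have "\<dots> \<le> emeasure M A"
    by (auto simp: \<epsilon>_def emeasure_eq_measure intro!: ennreal_leI)
  finally show False by simp
qed

section \<open>From essential infima to balls of positive measure\<close>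

lemma essinf_imp_AE_ball_pos:
  assumes inf0: "\<And>A. A \<in> sets M \<Longrightarrow> emeasure M A > 0 \<Longrightarrow>
    essinf (restrict_space (square_measure M) (A \<times> A)) (\<lambda>p. ennreal (case_prod \<rho> p)) = 0"
  shows "AE x in M. \<forall>\<epsilon>>0. emeasure M (semimetric_ball M \<rho> x \<epsilon>) > 0"
proof -
  obtain r where r[measurable]: "r \<in> borel_measurable (M \<Otimes>\<^sub>M M)"
    and eq: "AE p in M \<Otimes>\<^sub>M M. case_prod \<rho> p = r p"
    by (rule borel_version)
  define c where "c n = 1 / real (Suc n)" for n
  \<comment> \<open>Null balls are described through \<open>r\<close> instead of
    \<open>\<rho>\<close>: the measure of the ball then depends measurably on its center, so
    \<open>Z n\<close> is measurable.\<close>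
  define Z where "Z n = {x\<in>space M. emeasure M {y\<in>space M. r (x, y) < c n} = 0}" for n
  have Z[measurable]: "Z n \<in> sets M" for n unfolding Z_def by measurable
  have Z_null: "Z n \<in> null_sets M" for n
  proof (rule ccontr)
    assume "Z n \<notin> null_sets M"
    then have "emeasure M (Z n) > 0" using Z by (auto simp: null_sets_def zero_less_iff_neq_zero)
    from inf0[OF Z this] have no: "\<not> (AE p in restrict_space (square_measure M) (Z n \<times> Z n).
        ennreal (c n) \<le> ennreal (case_prod \<rho> p))"
      unfolding essinf_eq_0_iff by (simp add: c_def)
    have "AE p in M \<Otimes>\<^sub>M M. p \<in> Z n \<times> Z n \<longrightarrow> c n \<le> r p"
    proof (rule square.AE_pair_measure)
      show "{p \<in> space (M \<Otimes>\<^sub>M M). p \<in> Z n \<times> Z n \<longrightarrow> c n \<le> r p} \<in> sets (M \<Otimes>\<^sub>M M)"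
        by measurable
      show "AE x in M. AE y in M. (x, y) \<in> Z n \<times> Z n \<longrightarrow> c n \<le> r (x, y)"
      proof (rule AE_I2)
        fix x assume x: "x \<in> space M"
        show "AE y in M. (x, y) \<in> Z n \<times> Z n \<longrightarrow> c n \<le> r (x, y)"
        proof (cases "x \<in> Z n")
          case True
          then have "{y\<in>space M. r (x, y) < c n} \<in> null_sets M"
            using x by (intro null_setsI) (auto simp: Z_def)
          from AE_not_in[OF this] show ?thesis
            using AE_space by eventually_elim (auto simp: not_less)
        qed simp
      qed
    qed
    then have "AE p in M \<Otimes>\<^sub>M M. p \<in> Z n \<times> Z n \<longrightarrow> ennreal (c n) \<le> ennreal (case_prod \<rho> p)"
      using eq by eventually_elim (auto intro!: ennreal_leI)
    then show False using no AE_restrict_square_iff[OF Z] by blast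
  qed
  \<comment> \<open>The radii \<open>c n\<close> suffice because balls grow with the radius. For
    almost every center, the balls for \<open>r\<close> and for \<open>\<rho>\<close> differ by a
    null set.\<close>
  have "AE x in M. \<forall>n. x \<notin> Z n"
    unfolding AE_all_countable using AE_not_in[OF Z_null] by blast
  moreover have "AE x in M. AE y in M. case_prod \<rho> (x, y) = r (x, y)"
    by (rule square.AE_pair) (rule eq)
  ultimately show ?thesis
    using AE_measurable_section AE_space
  proof eventually_elim
    case (elim x)
    show ?case
    proof (intro allI impI)
      fix \<epsilon> :: real assume "\<epsilon> > 0"
      then obtain n where n: "c n < \<epsilon>"
        using reals_Archimedean[of \<epsilon>] by (auto simp: c_def inverse_eq_divide)
      have "0 < emeasure M {y\<in>space M. r (x, y) < c n}"
        using elim by (auto simp: Z_def zero_less_iff_neq_zero)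
      also have "\<dots> = emeasure M (semimetric_ball M \<rho> x (c n))"
      proof (rule emeasure_eq_AE)
        show "AE y in M. y \<in> {y\<in>space M. r (x, y) < c n} \<longleftrightarrow> y \<in> semimetric_ball M \<rho> x (c n)"
          using elim(2) by eventually_elim (auto simp: semimetric_ball_def)
      qed (use elim semimetric_ball_sets in auto)
      also have "\<dots> \<le> emeasure M (semimetric_ball M \<rho> x \<epsilon>)"
        by (rule emeasure_mono)
          (use elim n semimetric_ball_sets in \<open>auto simp: semimetric_ball_def\<close>)
      finally show "0 < emeasure M (semimetric_ball M \<rho> x \<epsilon>)" .
    qed
  qed
qed

section \<open>From balls of positive measure to separability\<close>

text \<open>Zorn's lemma supplies a maximal \<open>e\<close>-separated subset of \<open>G\<close>.
  Maximality makes it a net, and positivity of the disjoint balls of radius \<open>e / 2\<close>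
  makes it countable.\<close>

lemma countable_net:
  assumes G: "G \<subseteq> space M" and sec: "\<And>x. x \<in> G \<Longrightarrow> \<rho> x \<in> borel_measurable M"
    and pos: "\<And>x. x \<in> G \<Longrightarrow> emeasure M (semimetric_ball M \<rho> x (e / 2)) > 0" and e: "e > 0"
  shows "\<exists>S\<subseteq>G. countable S \<and> (\<forall>x\<in>G. \<exists>s\<in>S. \<rho> x s < e)"
proof -
  define \<A> where "\<A> = {S. S \<subseteq> G \<and> (\<forall>x\<in>S. \<forall>y\<in>S. x \<noteq> y \<longrightarrow> e \<le> \<rho> x y)}"
  have "\<exists>S\<in>\<A>. \<forall>S'\<in>\<A>. S \<subseteq> S' \<longrightarrow> S' = S"
  proof (rule subset_Zorn')
    fix \<C> assume "subset.chain \<A> \<C>"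
    then have C: "\<C> \<subseteq> \<A>" "\<And>S S'. S \<in> \<C> \<Longrightarrow> S' \<in> \<C> \<Longrightarrow> S \<subseteq> S' \<or> S' \<subseteq> S"
      by (auto simp: subset_chain_def)
    have "e \<le> \<rho> x y" if "x \<in> \<Union>\<C>" "y \<in> \<Union>\<C>" "x \<noteq> y" for x y
    proof -
      from that obtain S S' where "S \<in> \<C>" "S' \<in> \<C>" "x \<in> S" "y \<in> S'" by blast
      then obtain U where "U \<in> \<C>" "x \<in> U" "y \<in> U" using C(2) by blast
      then show ?thesis using C(1) that(3) by (auto simp: \<A>_def)
    qed
    then show "\<Union>\<C> \<in> \<A>" using C(1) by (auto simp: \<A>_def)
  qed
  then obtain S where S: "S \<in> \<A>" and max: "\<And>S'. S' \<in> \<A> \<Longrightarrow> S \<subseteq> S' \<Longrightarrow> S' = S" by blast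
  have SG: "S \<subseteq> G" and sepd: "\<And>x y. x \<in> S \<Longrightarrow> y \<in> S \<Longrightarrow> x \<noteq> y \<Longrightarrow> e \<le> \<rho> x y"
    using S by (auto simp: \<A>_def)
  have "countable S"
  proof (rule countable_disjoint_family_pos)
    show "semimetric_ball M \<rho> x (e / 2) \<in> sets M" if "x \<in> S" for x
      using semimetric_ball_sets sec SG that by blast
    show "0 < measure M (semimetric_ball M \<rho> x (e / 2))" if "x \<in> S" for x
      using pos[of x] SG that by (auto simp: emeasure_eq_measure)
    show "disjoint_family_on (\<lambda>x. semimetric_ball M \<rho> x (e / 2)) S"
      unfolding disjoint_family_on_def
    proof (intro ballI impI)
      fix x y assume xy: "x \<in> S" "y \<in> S" "x \<noteq> y"
      then have xyM: "x \<in> space M" "y \<in> space M" using SG G by auto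
      have False if "z \<in> space M" "\<rho> x z < e / 2" "\<rho> y z < e / 2" for z
        using that rho_triangle[of x z y] rho_sym[of y z] sepd[OF xy] xyM by simp
      then show "semimetric_ball M \<rho> x (e / 2) \<inter> semimetric_ball M \<rho> y (e / 2) = {}"
        by (auto simp: semimetric_ball_def)
    qed
  qed
  moreover have "\<exists>s\<in>S. \<rho> x s < e" if x: "x \<in> G" for x
  proof (rule ccontr)
    assume far: "\<not> (\<exists>s\<in>S. \<rho> x s < e)"
    have far1: "e \<le> \<rho> x s" "e \<le> \<rho> s x" if s: "s \<in> S" for s
    proof -
      show "e \<le> \<rho> x s" using far s by (auto simp: not_less)
      moreover have "s \<in> space M" "x \<in> space M" using s x SG G by auto
      ultimately show "e \<le> \<rho> s x" using rho_sym[of s x] by simp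
    qed
    \<comment> \<open>Maximality puts \<open>x\<close> itself into \<open>S\<close>, and then
      \<open>\<rho> x x = 0\<close> contradicts the assumed distance from all of
      \<open>S\<close>.\<close>
    have "insert x S \<in> \<A>"
      unfolding \<A>_def using x SG sepd far1 by blast
    then have "x \<in> S" using max[of "insert x S"] by blast
    moreover have "x \<in> space M" using x G by blast
    ultimately show False using far rho_refl[of x] e by force
  qed
  ultimately show ?thesis using SG by blast
qed

text \<open>Removing a null set leaves \<open>G\<close>, on which all sections are measurable and
  all balls have positive measure. The union of countable nets at the scales
  \<open>1 / (n + 1)\<close> is dense in \<open>G\<close> and has its points in
  \<open>G\<close>.\<close>

lemma AE_ball_pos_imp_admissible:
  assumes pos: "AE x in M. \<forall>\<epsilon>>0. emeasure M (semimetric_ball M \<rho> x \<epsilon>) > 0"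
  shows "admissible_semimetric M \<rho>"
proof -
  have "AE x in M. \<rho> x \<in> borel_measurable M \<and> (\<forall>\<epsilon>>0. emeasure M (semimetric_ball M \<rho> x \<epsilon>) > 0)"
    using pos AE_measurable_section by eventually_elim auto
  then obtain N where N: "N \<in> null_sets M"
    "{x\<in>space M. \<not> (\<rho> x \<in> borel_measurable M \<and>
        (\<forall>\<epsilon>>0. emeasure M (semimetric_ball M \<rho> x \<epsilon>) > 0))} \<subseteq> N"
    unfolding eventually_ae_filter by blast
  define G where "G = space M - N"
  have G: "G \<subseteq> space M" "\<And>x. x \<in> G \<Longrightarrow> \<rho> x \<in> borel_measurable M"
    "\<And>x e. x \<in> G \<Longrightarrow> e > 0 \<Longrightarrow> emeasure M (semimetric_ball M \<rho> x e) > 0"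
    using N(2) by (auto simp only: G_def)
  have G_sets: "G \<in> sets M" using N(1) by (auto simp: G_def)
  have "space M - G = N" using N(1) sets.sets_into_space by (auto simp: G_def)
  then have G_null: "space M - G \<in> null_sets M" using N(1) by simp
  have "\<exists>S\<subseteq>G. countable S \<and> (\<forall>x\<in>G. \<exists>s\<in>S. \<rho> x s < 1 / real (Suc n))" for n
    by (rule countable_net) (use G in simp_all)
  then obtain S where S: "\<And>n. S n \<subseteq> G" "\<And>n. countable (S n)"
      "\<And>n x. x \<in> G \<Longrightarrow> \<exists>s\<in>S n. \<rho> x s < 1 / real (Suc n)"
    by metis
  have "separable_on G \<rho>"
    unfolding separable_on_def
  proof (intro exI[of _ "\<Union>n. S n"] conjI ballI allI impI)
    fix x and \<epsilon> :: real assume x: "x \<in> G" and "\<epsilon> > 0"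
    then obtain n where "1 / real (Suc n) < \<epsilon>"
      using reals_Archimedean[of \<epsilon>] by (auto simp: inverse_eq_divide)
    with S(3)[OF x, of n] show "\<exists>s\<in>(\<Union>n. S n). \<rho> x s < \<epsilon>"
      by (meson UNIV_I UN_I less_trans)
  qed (use S in auto)
  then show ?thesis
    unfolding admissible_semimetric_def using meas G_sets G_null by blast
qed

end

section \<open>Closing the cycle of implications\<close>

theorem theorem2:
  fixes M :: "'a measure" and \<rho> :: "'a \<Rightarrow> 'a \<Rightarrow> real"
  assumes "lebesgue_prob_space M"
    and "measurable_semimetric M \<rho>"
    and "summable_semimetric M \<rho>"
  shows
    "(admissible_semimetric M \<rho> \<longleftrightarrow>
        (\<forall>\<epsilon>>0. eps_entropy \<epsilon> \<rho> M < \<infinity>)) \<and>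
     (admissible_semimetric M \<rho> \<longleftrightarrow>
        (\<forall>\<epsilon>>0. \<exists>\<nu>. prob_space \<nu> \<and> sets \<nu> = sets M \<and> finitely_supported \<nu> \<and>
           kantorovich \<rho> M \<nu> < ennreal \<epsilon>)) \<and>
     (admissible_semimetric M \<rho> \<longleftrightarrow>
        (AE x in M. \<forall>\<epsilon>>0. emeasure M (semimetric_ball M \<rho> x \<epsilon>) > 0)) \<and>
     (admissible_semimetric M \<rho> \<longleftrightarrow>
        (\<forall>\<epsilon>>0. \<exists>k. \<exists>X::nat \<Rightarrow> 'a set. (\<forall>j\<le>k. X j \<in> sets M) \<and> (\<Union>j\<le>k. X j) = space M \<and>
           emeasure M (X 0) < ennreal \<epsilon> \<and> (\<forall>j\<in>{1..k}. essdiam M \<rho> (X j) < ennreal \<epsilon>))) \<and>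
     (admissible_semimetric M \<rho> \<longleftrightarrow>
        (\<forall>A\<in>sets M. emeasure M A > 0 \<longrightarrow>
           essinf (restrict_space (square_measure M) (A \<times> A)) (\<lambda>p. ennreal (case_prod \<rho> p)) = 0))"
proof -
  interpret prob_space M using assms(1) by (simp add: lebesgue_prob_space_def)
  interpret complete_measure M using assms(1) by (simp add: lebesgue_prob_space_def)
  interpret summable_semimetric_space M \<rho>
    by unfold_locales (use assms lebesgue_prob_space_singleton in auto)
  let ?K = "\<lambda>\<epsilon>. \<exists>\<nu>. prob_space \<nu> \<and> sets \<nu> = sets M \<and> finitely_supported \<nu> \<and>
      kantorovich \<rho> M \<nu> < ennreal \<epsilon>"
  let ?E = "\<lambda>\<epsilon>. \<exists>k. \<exists>X::nat \<Rightarrow> 'a set. (\<forall>j\<le>k. X j \<in> sets M) \<and> (\<Union>j\<le>k. X j) = space M \<and>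
      emeasure M (X 0) < ennreal \<epsilon> \<and> (\<forall>j\<in>{1..k}. essdiam M \<rho> (X j) < ennreal \<epsilon>)"
  let ?I = "\<lambda>A. essinf (restrict_space (square_measure M) (A \<times> A)) (\<lambda>p. ennreal (case_prod \<rho> p)) = 0"
  let ?c1 = "admissible_semimetric M \<rho>" and ?c2 = "\<forall>\<epsilon>>0. eps_entropy \<epsilon> \<rho> M < \<infinity>"
    and ?c3 = "\<forall>\<epsilon>>0. ?K \<epsilon>"
    and ?c4 = "AE x in M. \<forall>\<epsilon>>0. emeasure M (semimetric_ball M \<rho> x \<epsilon>) > 0"
    and ?c5 = "\<forall>\<epsilon>>0. ?E \<epsilon>" and ?c6 = "\<forall>A\<in>sets M. emeasure M A > 0 \<longrightarrow> ?I A"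
  \<comment> \<open>The labels \<open>1\<close> to \<open>6\<close> count the implications along the
    cycle, not the conditions; each equivalence below composes the arcs leading from
    \<open>?c1\<close> to the condition and back.\<close>
  have 1: ?c3 if ?c1
    using admissible_imp_kantorovich[OF that] by (intro allI impI)
  have 2: ?c2 if c3: ?c3
    unfolding eps_entropy_finite_iff
  proof (intro allI impI)
    fix \<epsilon> :: real assume "\<epsilon> > 0"
    then show "\<exists>k\<ge>1. entropy_cover M \<rho> \<epsilon> k"
      by (intro kantorovich_imp_entropy_cover c3[rule_format])
  qed
  have 3: ?c5 if c2: ?c2
  proof (intro allI impI)
    fix \<epsilon> :: real assume "\<epsilon> > 0"
    then obtain k where "entropy_cover M \<rho> \<epsilon> k"
      using c2 unfolding eps_entropy_finite_iff by blast
    then show "?E \<epsilon>" by (rule entropy_cover_imp_essdiam_cover)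
  qed
  have 4: ?c6 if c5: ?c5
    by (intro ballI impI essdiam_cover_imp_essinf c5[rule_format])
  have 5: ?c4 if c6: ?c6
    by (intro essinf_imp_AE_ball_pos c6[rule_format])
  have 6: ?c1 if ?c4
    by (rule AE_ball_pos_imp_admissible[OF that])
  show ?thesis
  proof (intro conjI)
    show "?c1 = ?c2" by (rule iffI, erule 2[OF 1], erule 6[OF 5[OF 4[OF 3]]])
    show "?c1 = ?c3" by (rule iffI, erule 1, erule 6[OF 5[OF 4[OF 3[OF 2]]]])
    show "?c1 = ?c4" by (rule iffI, erule 5[OF 4[OF 3[OF 2[OF 1]]]], erule 6)
    show "?c1 = ?c5" by (rule iffI, erule 3[OF 2[OF 1]], erule 6[OF 5[OF 4]])
    show "?c1 = ?c6" by (rule iffI, erule 4[OF 3[OF 2[OF 1]]], erule 6[OF 5])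
  qed
qed

end
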